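(* We have $$A^{(1)}(x_1,x_2,x_3,\dots)=1+\frac{x_1^2A^{(1)}(x_1x_2,x_2x_3,x_3x_4,\dots)}{1-x_1^2x_2A^{(1)}(x_1x_2^2x_3,x_2x_3^2x_4,x_3x_4^2x_5,\dots)},$$ and $$B^{(1)}(x_1,x_2,x_3,\dots)=x_1A^{(1)}(x_1x_2,x_2x_3,x_3x_4,\dots).$$
   Context: A permutation $\pi$ is a Dumont permutation (of the first kind) if each even integer in $\pi$ is followed by a smaller integer, and each odd integer is either followed by a larger integer or is the last element of $\pi$. Let $\mathcal{D}$ denote the set of Dumont permutations of all sizes (including the empty one) that avoid the pattern $132$. For a pattern $\tau$, let $\tau(\pi)$ be the number of occurrences of $\tau$ in $\pi$. Define $\mathcal{A}(x_1,x_2,x_3,\dots)=\sum_{\pi\in\mathcal{D}}\prod_{j\geq1} x_j^{12\dots j(\pi)}$, and $A^{(1)}(x_1,x_2,\dots)=\frac{1}{2}(\mathcal{A}(x_1,x_2,x_3,\dots)+\mathcal{A}(-x_1,x_2,x_3,\dots))$, $B^{(1)}(x_1,x_2,\dots)=\frac{1}{2}(\mathcal{A}(x_1,x_2,x_3,\dots)-\mathcal{A}(-x_1,x_2,x_3,\dots))$. *)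

theory Defs
  imports Complex_Main "HOL-Library.Poly_Mapping" "HOL-Combinatorics.Multiset_Permutations"
begin

section \<open>Formal power series in the variables \<open>x\<^sub>1, x\<^sub>2, \<dots>\<close>\<close>

text \<open>
  A monomial is a finitely supported exponent function \<open>nat \<Rightarrow>\<^sub>0 nat\<close>, and a series is an arbitrary
  assignment of coefficients to monomials.  The index \<open>0\<close> exists in the type, but the variable
  \<open>x\<^sub>0\<close> is never used.
\<close>

typedef 'a mfps = "UNIV :: ((nat \<Rightarrow>\<^sub>0 nat) \<Rightarrow> 'a) set"
  morphisms mcoeff Abs_mfps by simp

lemma mcoeff_Abs [simp]: "mcoeff (Abs_mfps f) = f"
  by (simp add: Abs_mfps_inverse)

lemma mfps_eqI: "(\<And>m. mcoeff f m = mcoeff g m) \<Longrightarrow> f = g"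
  by (metis ext mcoeff_inject)

definition mdecomp :: "(nat \<Rightarrow>\<^sub>0 nat) \<Rightarrow> ((nat \<Rightarrow>\<^sub>0 nat) \<times> (nat \<Rightarrow>\<^sub>0 nat)) set" where
  "mdecomp m = {(s, t). s + t = m}"

lemma finite_mdecomp [simp]: "finite (mdecomp m)"
proof -
  let ?F = "{f. \<forall>i. (i \<in> Poly_Mapping.keys m \<longrightarrow>
                     f i \<in> {..Max (Poly_Mapping.lookup m ` Poly_Mapping.keys m)}) \<and>
                 (i \<notin> Poly_Mapping.keys m \<longrightarrow> f i = (0::nat))}"
  have fin: "finite ?F"
    by (rule finite_set_of_finite_funs) auto
  have sub: "Poly_Mapping.lookup ` fst ` mdecomp m \<subseteq> ?F"
  proof (clarsimp simp: mdecomp_def, intro allI conjI impI)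
    fix s t :: "nat \<Rightarrow>\<^sub>0 nat" and i
    assume "i \<in> Poly_Mapping.keys (s + t)"
    then have "Poly_Mapping.lookup (s + t) i \<le> Max (Poly_Mapping.lookup (s + t) ` Poly_Mapping.keys (s + t))" by (intro Max_ge) auto
    then show "Poly_Mapping.lookup s i \<le> Max (Poly_Mapping.lookup (s + t) ` Poly_Mapping.keys (s + t))" by (simp add: lookup_add)
  next
    fix s t :: "nat \<Rightarrow>\<^sub>0 nat" and i
    assume "i \<notin> Poly_Mapping.keys (s + t)"
    then show "Poly_Mapping.lookup s i = 0" by (simp add: in_keys_iff lookup_add)
  qed
  have "finite (Poly_Mapping.lookup ` fst ` mdecomp m)" using finite_subset[OF sub fin] .
  then have "finite (fst ` mdecomp m)"
    by (rule finite_imageD) (simp add: inj_on_def poly_mapping_eqI)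
  then show ?thesis
    by (rule finite_imageD) (auto simp: inj_on_def mdecomp_def)
qed

instantiation mfps :: (comm_ring_1) comm_ring_1
begin

definition "0 = Abs_mfps (\<lambda>_. 0)"
definition "1 = Abs_mfps (\<lambda>m. if m = 0 then 1 else 0)"
definition "f + g = Abs_mfps (\<lambda>m. mcoeff f m + mcoeff g m)"
definition "f - g = Abs_mfps (\<lambda>m. mcoeff f m - mcoeff g m)"
definition "- f = Abs_mfps (\<lambda>m. - mcoeff f m)"
definition "f * g = Abs_mfps (\<lambda>m. \<Sum>(s, t)\<in>mdecomp m. mcoeff f s * mcoeff g t)"

instance
proof
  fix a b c :: "'a mfps"
  show "a * b * c = a * (b * c)"
  proof (rule mfps_eqI)
    fix m
    have "mcoeff (a * b * c) m =
        (\<Sum>p\<in>mdecomp m. \<Sum>q\<in>mdecomp (fst p). mcoeff a (fst q) * mcoeff b (snd q) * mcoeff c (snd p))"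
      by (simp add: times_mfps_def case_prod_unfold sum_distrib_right)
    also have "\<dots> = (\<Sum>(p, q)\<in>(SIGMA p:mdecomp m. mdecomp (fst p)).
        mcoeff a (fst q) * mcoeff b (snd q) * mcoeff c (snd p))"
      by (rule sum.Sigma) auto
    also have "\<dots> = (\<Sum>(p, q)\<in>(SIGMA p:mdecomp m. mdecomp (snd p)).
        mcoeff a (fst p) * (mcoeff b (fst q) * mcoeff c (snd q)))"
      by (rule sum.reindex_bij_witness[where
            j = "\<lambda>(p, q). ((fst q, snd q + snd p), (snd q, snd p))" and
            i = "\<lambda>(p, q). ((fst p + fst q, snd q), (fst p, fst q))"])
         (auto simp: mdecomp_def ac_simps)
    also have "\<dots> = mcoeff (a * (b * c)) m"
      by (subst sum.Sigma[symmetric])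
         (auto simp: times_mfps_def case_prod_unfold sum_distrib_left)
    finally show "mcoeff (a * b * c) m = mcoeff (a * (b * c)) m" .
  qed
  show "a * b = b * a"
  proof (rule mfps_eqI)
    fix m
    show "mcoeff (a * b) m = mcoeff (b * a) m"
      unfolding times_mfps_def mcoeff_Abs
      by (rule sum.reindex_bij_witness[where i = prod.swap and j = prod.swap])
         (auto simp: mdecomp_def ac_simps)
  qed
  show "1 * a = a"
  proof (rule mfps_eqI)
    fix m
    have "mcoeff (1 * a) m = (\<Sum>p\<in>{(0, m)}. mcoeff (1::'a mfps) (fst p) * mcoeff a (snd p))"
      unfolding times_mfps_def mcoeff_Abs case_prod_unfold
      by (rule sum.mono_neutral_right, simp) (auto simp: mdecomp_def one_mfps_def)
    then show "mcoeff (1 * a) m = mcoeff a m" by (simp add: one_mfps_def)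
  qed
  show "(a + b) * c = a * c + b * c"
    by (rule mfps_eqI)
       (simp add: times_mfps_def plus_mfps_def case_prod_unfold sum.distrib distrib_right)
  show "(0::'a mfps) \<noteq> 1"
    by (auto simp: zero_mfps_def one_mfps_def Abs_mfps_inject fun_eq_iff)
qed (auto simp: zero_mfps_def plus_mfps_def minus_mfps_def uminus_mfps_def intro!: mfps_eqI)

end

lemma mcoeff_simps [simp]:
  "mcoeff 0 m = 0" "mcoeff 1 m = (if m = 0 then 1 else 0)"
  "mcoeff (f + g) m = mcoeff f m + mcoeff g m"
  "mcoeff (f - g) m = mcoeff f m - mcoeff g m"
  "mcoeff (- f) m = - mcoeff f m"
  by (simp_all add: zero_mfps_def one_mfps_def plus_mfps_def minus_mfps_def uminus_mfps_def)

lemma mcoeff_times: "mcoeff (f * g) m = (\<Sum>(s, t)\<in>mdecomp m. mcoeff f s * mcoeff g t)"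
  by (simp add: times_mfps_def)

text \<open>
  Non-units get the inverse \<open>0\<close>.  Every series with non-zero constant coefficient is a unit
  (lemma \<open>mfps_inverse_mult\<close> below), so quotients by such series are genuine.
\<close>

instantiation mfps :: (field) inverse
begin

definition "inverse f = (if \<exists>h. f * h = 1 then THE h. f * h = 1 else (0 :: 'a mfps))"
definition "f div g = f * inverse (g :: 'a mfps)"

instance ..

end

lemma mfps_inverse_unique:
  fixes f :: "'a::field mfps"
  assumes "f * h = 1" shows "inverse f = h"
proof -
  have "k = h" if "f * k = 1" for k
    using assms that by (metis mult.assoc mult.commute mult_1)
  then have "(THE h. f * h = 1) = h" using assms by blast
  then show ?thesis using assms by (auto simp: inverse_mfps_def)
qed

definition mdeg :: "(nat \<Rightarrow>\<^sub>0 nat) \<Rightarrow> nat" where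
  "mdeg m = (\<Sum>i\<in>Poly_Mapping.keys m. Poly_Mapping.lookup m i)"

lemma mdeg_add: "mdeg (s + t) = mdeg s + mdeg t"
proof -
  have *: "mdeg u = (\<Sum>i\<in>Poly_Mapping.keys s \<union> Poly_Mapping.keys t. Poly_Mapping.lookup u i)" if "Poly_Mapping.keys u \<subseteq> Poly_Mapping.keys s \<union> Poly_Mapping.keys t" for u
    unfolding mdeg_def by (rule sum.mono_neutral_left) (use that in \<open>auto simp: in_keys_iff\<close>)
  show ?thesis
    by (subst (1 2 3) *) (auto simp: lookup_add sum.distrib in_keys_iff)
qed

lemma mdeg_eq_0: "mdeg m = 0 \<Longrightarrow> m = 0"
  by (rule poly_mapping_eqI) (auto simp: mdeg_def in_keys_iff)

lemma mcoeff_power_eq_0: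
  assumes "mcoeff u 0 = 0" "mdeg m < k"
  shows "mcoeff (u ^ k) m = 0"
  using assms(2)
proof (induction k arbitrary: m)
  case (Suc k)
  have "mcoeff u s * mcoeff (u ^ k) t = 0" if "s + t = m" for s t
  proof (cases "s = 0")
    case False
    then have "mdeg s > 0" using mdeg_eq_0 by blast
    then have "mdeg t < k" using Suc.prems that mdeg_add[of s t] by simp
    then show ?thesis using Suc.IH by simp
  qed (simp add: assms)
  then show ?case by (auto simp: mcoeff_times mdecomp_def intro!: sum.neutral)
qed simp

lemma mfps_geometric_inverse:
  fixes u :: "'a::comm_ring_1 mfps"
  assumes "mcoeff u 0 = 0"
  shows "(1 - u) * Abs_mfps (\<lambda>m. \<Sum>k\<le>mdeg m. mcoeff (u ^ k) m) = 1" (is "_ * ?h = 1")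
proof (rule mfps_eqI)
  fix m
  define N where "N = mdeg m"
  define H where "H = (\<Sum>k\<le>N. u ^ k)"
  have coeff_sum: "mcoeff (\<Sum>k\<in>K. u ^ k) t = (\<Sum>k\<in>K. mcoeff (u ^ k) t)" if "finite K" for K t
    using that by induction auto
  have eq: "mcoeff ?h t = mcoeff H t" if "s + t = m" for s t
  proof -
    have "mdeg t \<le> N" using that mdeg_add[of s t] N_def by simp
    then show ?thesis
      unfolding H_def coeff_sum[OF finite_atMost] mcoeff_Abs
      by (intro sum.mono_neutral_left) (auto intro: mcoeff_power_eq_0[OF assms])
  qed
  have "mcoeff ((1 - u) * ?h) m = mcoeff ((1 - u) * H) m"
    unfolding mcoeff_times by (rule sum.cong) (auto simp: mdecomp_def eq simp del: mcoeff_Abs)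
  also have "(1 - u) * H = 1 - u ^ Suc N"
    unfolding H_def by (rule sum_gp_basic)
  also have "mcoeff \<dots> m = mcoeff 1 m"
    using mcoeff_power_eq_0[OF assms, of m "Suc N"] by (simp add: N_def del: power_Suc)
  finally show "mcoeff ((1 - u) * ?h) m = mcoeff 1 m" .
qed

lemma mfps_inverse_mult:
  fixes f :: "'a::field mfps"
  assumes "mcoeff f 0 \<noteq> 0"
  shows "f * inverse f = 1"
proof -
  define c where "c = mcoeff f 0"
  define C where "C = Abs_mfps (\<lambda>m. if m = 0 then inverse c else 0)"
  have C: "mcoeff (C * g) m = inverse c * mcoeff g m" for g m
  proof -
    have "mcoeff (C * g) m = (\<Sum>p\<in>{(0, m)}. mcoeff C (fst p) * mcoeff g (snd p))"
      unfolding mcoeff_times case_prod_unfold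
      by (rule sum.mono_neutral_right, simp) (auto simp: mdecomp_def C_def)
    then show ?thesis by (simp add: C_def)
  qed
  have "mcoeff (1 - C * f) 0 = 0" using assms by (simp add: C c_def)
  from mfps_geometric_inverse[OF this] obtain h where "C * f * h = 1" by auto
  then have "f * (C * h) = 1" by (simp add: ac_simps)
  then show ?thesis using mfps_inverse_unique by metis
qed

definition mvar :: "nat \<Rightarrow> 'a::comm_ring_1 mfps" where
  "mvar i = Abs_mfps (\<lambda>m. if m = Poly_Mapping.single i 1 then 1 else 0)"

text \<open>
  Sum of a possibly infinite family of series, coefficient by coefficient; it is meaningful if each
  monomial occurs in only finitely many members of the family.
\<close>

definition mfps_Sum :: "('b \<Rightarrow> 'a::comm_ring_1 mfps) \<Rightarrow> 'b set \<Rightarrow> 'a mfps" where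
  "mfps_Sum F S = Abs_mfps (\<lambda>m. \<Sum>p | p \<in> S \<and> mcoeff (F p) m \<noteq> 0. mcoeff (F p) m)"

text \<open>
  \<open>mfps_subst f g\<close> is \<open>f(g 1, g 2, \<dots>)\<close>.  The monomial \<open>m\<close> with coefficient \<open>c\<close> contributes
  the series \<open>c \<cdot> \<Prod>\<^sub>i (g i)\<^sup>m\<^sup>i\<close>.
\<close>

definition mfps_subst :: "'a::comm_ring_1 mfps \<Rightarrow> (nat \<Rightarrow> 'a mfps) \<Rightarrow> 'a mfps" where
  "mfps_subst f g =
     mfps_Sum (\<lambda>m. Abs_mfps (\<lambda>n. mcoeff f m * mcoeff (\<Prod>i\<in>Poly_Mapping.keys m. g i ^ Poly_Mapping.lookup m i) n)) UNIV"


section \<open>Permutations and patterns\<close>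

text \<open>Permutations of \<open>{1..n}\<close> are written in one-line notation, as lists.\<close>

definition dumont :: "nat list \<Rightarrow> bool" where
  "dumont w \<longleftrightarrow>
     (\<forall>i<length w.
        (even (w ! i) \<longrightarrow> i + 1 < length w \<and> w ! (i + 1) < w ! i) \<and>
        (odd (w ! i) \<longrightarrow> i + 1 = length w \<or> w ! i < w ! (i + 1)))"

definition order_isomorphic :: "nat list \<Rightarrow> nat list \<Rightarrow> bool" where
  "order_isomorphic v w \<longleftrightarrow> length v = length w \<and>
     (\<forall>i<length v. \<forall>j<length v. v ! i < v ! j \<longleftrightarrow> w ! i < w ! j)"

text \<open>An occurrence of a pattern is identified with its set of (zero-based) positions.\<close>

definition occurrences :: "nat list \<Rightarrow> nat list \<Rightarrow> nat" where
  "occurrences p w = card {I. I \<subseteq> {..<length w} \<and> order_isomorphic (nths w I) p}"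

definition dumont132 :: "nat list set" where
  "dumont132 = {w. \<exists>n. w \<in> permutations_of_set {1..n} \<and> dumont w \<and> occurrences [1, 3, 2] w = 0}"

text \<open>
  The factors with \<open>j > length w\<close> are trivial, as \<open>w\<close> is too short to contain \<open>12\<dots>j\<close>.
  The exponent of \<open>x\<^sub>1\<close> is \<open>length w\<close>, so each monomial arises from finitely many \<open>w\<close>.
\<close>

definition dumont_gf :: "'a::comm_ring_1 mfps" where
  "dumont_gf = mfps_Sum (\<lambda>w. \<Prod>j = 1..length w. mvar j ^ occurrences [1..<j + 1] w) dumont132"

definition dumont_gf_neg :: "'a::comm_ring_1 mfps" where
  "dumont_gf_neg = mfps_subst dumont_gf (\<lambda>i. if i = 1 then - mvar 1 else mvar i)"

definition dumont_A :: "'a::field_char_0 mfps" where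
  "dumont_A = 1 / 2 * (dumont_gf + dumont_gf_neg)"

definition dumont_B :: "'a::field_char_0 mfps" where
  "dumont_B = 1 / 2 * (dumont_gf - dumont_gf_neg)"

end

theory Submission
  imports Defs "HOL-Library.Sublist"
begin

text \<open>
  Split a 132-avoiding Dumont permutation at its maximum: \<open>\<pi> = (\<alpha>, n, \<beta>)\<close> with all entries of \<open>\<alpha>\<close> above
  those of \<open>\<beta>\<close>.  If \<open>n\<close> is odd, then \<open>\<beta>\<close> is empty and \<open>\<alpha>\<close> is an arbitrary member of even size.
  If \<open>n\<close> is even, then \<open>\<beta>\<close> is non-empty, and either \<open>\<alpha>\<close> is empty and \<open>\<beta>\<close> has odd size, or \<open>\<alpha>\<close> has
  odd size and \<open>\<beta>\<close> has even size, because the least entry of a non-empty \<open>\<alpha>\<close> is followed by a larger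
  one and hence is odd.  Appending a new maximum to \<open>\<alpha>\<close> turns every occurrence of \<open>12\<dots>j\<close> into one
  more occurrence of \<open>12\<dots>(j + 1)\<close>, that is, substitutes \<open>x\<^sub>j x\<^sub>j\<^sub>+\<^sub>1\<close> for \<open>x\<^sub>j\<close>, while no increasing
  pattern meets both \<open>(\<alpha>, n)\<close> and \<open>\<beta>\<close>.  With \<open>A\<^sub>1\<close>, \<open>A\<^sub>2\<close> for the one- and two-fold substitution
  this reads \<open>B = x\<^sub>1 A\<^sub>1\<close> and \<open>A = 1 + x\<^sub>1 B + x\<^sub>1\<^sup>2 x\<^sub>2 A\<^sub>2 (A - 1)\<close>.
\<close>

section \<open>Counting series\<close>

abbreviation lookup :: "('a \<Rightarrow>\<^sub>0 'b::zero) \<Rightarrow> 'a \<Rightarrow> 'b" where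
  "lookup \<equiv> Poly_Mapping.lookup"

abbreviation keys :: "('a \<Rightarrow>\<^sub>0 'b::zero) \<Rightarrow> 'a set" where
  "keys \<equiv> Poly_Mapping.keys"

abbreviation single :: "'a \<Rightarrow> 'b \<Rightarrow> ('a \<Rightarrow>\<^sub>0 'b::zero)" where
  "single \<equiv> Poly_Mapping.single"

definition monomial :: "(nat \<Rightarrow>\<^sub>0 nat) \<Rightarrow> 'a::comm_ring_1 mfps" where
  "monomial a = Abs_mfps (\<lambda>m. if m = a then 1 else 0)"

text \<open>Since \<open>card\<close> of an infinite set is 0, the coefficients are true counts only
  under \<open>finite_fibres\<close>. Sums and products of such series rest on that condition;
  reindexing along an injection does not.\<close>

definition gf :: "'b set \<Rightarrow> ('b \<Rightarrow> (nat \<Rightarrow>\<^sub>0 nat)) \<Rightarrow> 'a::comm_ring_1 mfps" where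
  "gf S f = Abs_mfps (\<lambda>m. of_nat (card {x \<in> S. f x = m}))"

definition finite_fibres :: "'b set \<Rightarrow> ('b \<Rightarrow> 'c) \<Rightarrow> bool" where
  "finite_fibres S f \<longleftrightarrow> (\<forall>m. finite {x \<in> S. f x = m})"

lemma finite_fibresD: "finite_fibres S f \<Longrightarrow> finite {x \<in> S. f x = m}"
  by (simp add: finite_fibres_def)

lemma mcoeff_gf [simp]: "mcoeff (gf S f) m = of_nat (card {x \<in> S. f x = m})"
  by (simp add: gf_def)

lemma mcoeff_monomial [simp]: "mcoeff (monomial a) m = (if m = a then 1 else 0)"
  by (simp add: monomial_def)

lemma mvar_eq_monomial: "mvar i = monomial (single i 1)"
  by (simp add: mvar_def monomial_def)

lemma monomial_0: "monomial 0 = 1"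
  by (rule mfps_eqI) simp

text \<open>Makes multiplication by a monomial an instance of \<open>gf_times\<close>.\<close>

lemma monomial_eq_gf: "monomial a = gf {()} (\<lambda>_. a)"
  by (rule mfps_eqI) auto

lemma gf_cong: "(\<And>x. x \<in> S \<Longrightarrow> f x = g x) \<Longrightarrow> gf S f = gf S g"
  by (rule mfps_eqI) (simp cong: conj_cong)

lemma gf_image: "inj_on h S \<Longrightarrow> gf (h ` S) f = gf S (\<lambda>x. f (h x))"
proof (rule mfps_eqI)
  fix m
  assume "inj_on h S"
  then have "card (h ` {x \<in> S. f (h x) = m}) = card {x \<in> S. f (h x) = m}"
    by (intro card_image) (auto simp: inj_on_def)
  moreover have "h ` {x \<in> S. f (h x) = m} = {y \<in> h ` S. f y = m}" by auto
  ultimately show "mcoeff (gf (h ` S) f) m = mcoeff (gf S (\<lambda>x. f (h x))) m" by simp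
qed

lemma gf_Un:
  assumes "S \<inter> T = {}" "finite_fibres S f" "finite_fibres T f"
  shows "gf (S \<union> T) f = gf S f + gf T f"
proof (rule mfps_eqI)
  fix m
  have "{x \<in> S \<union> T. f x = m} = {x \<in> S. f x = m} \<union> {x \<in> T. f x = m}" by auto
  then have "card {x \<in> S \<union> T. f x = m} = card {x \<in> S. f x = m} + card {x \<in> T. f x = m}"
    using assms by (simp add: finite_fibresD) (rule card_Un_disjoint, auto simp: finite_fibresD)
  then show "mcoeff (gf (S \<union> T) f) m = mcoeff (gf S f + gf T f) m" by simp
qed

text \<open>The fibre of the summed weight over \<open>m\<close> is the disjoint union, over all
  splittings \<open>s + t = m\<close>, of products of fibres; taking cardinalities gives the
  convolution.\<close>

lemma gf_times:
  assumes "finite_fibres S f" "finite_fibres T g"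
  shows "gf S f * gf T g = gf (S \<times> T) (\<lambda>(x, y). f x + g y)"
proof (rule mfps_eqI)
  fix m
  let ?F = "\<lambda>(s, t). {x \<in> S. f x = s} \<times> {y \<in> T. g y = t}"
  have "{p \<in> S \<times> T. (case p of (x, y) \<Rightarrow> f x + g y) = m} = (\<Union>p\<in>mdecomp m. ?F p)"
    by (auto simp: mdecomp_def)
  moreover have "card (\<Union>p\<in>mdecomp m. ?F p) = (\<Sum>p\<in>mdecomp m. card (?F p))"
    by (rule card_UN_disjoint) (use assms in \<open>auto simp: finite_fibresD\<close>)
  ultimately show "mcoeff (gf S f * gf T g) m = mcoeff (gf (S \<times> T) (\<lambda>(x, y). f x + g y)) m"
    by (simp add: mcoeff_times case_prod_unfold card_cartesian_product)
qed

lemma monomial_times_gf: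
  assumes "finite_fibres S f"
  shows "monomial a * gf S f = gf S (\<lambda>x. a + f x)"
proof -
  have "monomial a * gf S f = gf ({()} \<times> S) (\<lambda>(_, x). a + f x)"
    unfolding monomial_eq_gf using assms by (subst gf_times) (auto simp: finite_fibres_def)
  also have "{()} \<times> S = Pair () ` S" by auto
  also have "gf (Pair () ` S) (\<lambda>(_, x). a + f x) = gf S (\<lambda>x. a + f x)"
    by (subst gf_image) (auto simp: inj_on_def)
  finally show ?thesis .
qed

lemma monomial_mult: "monomial a * monomial b = monomial (a + b)"
  unfolding monomial_eq_gf[of b]
  by (subst monomial_times_gf) (auto simp: finite_fibres_def monomial_eq_gf)

lemma monomial_power: "monomial a ^ k = monomial (of_nat k * a)"
  by (induction k) (simp_all add: monomial_0 monomial_mult distrib_right)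

lemma monomial_sum: "(\<Prod>i\<in>I. monomial (f i)) = monomial (\<Sum>i\<in>I. f i)"
  by (induction I rule: infinite_finite_induct) (simp_all add: monomial_0 monomial_mult)

lemma lookup_of_nat_mult: "lookup (of_nat k * a :: nat \<Rightarrow>\<^sub>0 nat) i = k * lookup a i"
  by (induction k) (simp_all add: distrib_right lookup_add)

lemma of_nat_mult_single: "of_nat k * single i 1 = (single i k :: nat \<Rightarrow>\<^sub>0 nat)"
  by (rule poly_mapping_eqI) (simp add: lookup_of_nat_mult lookup_single when_def)

lemma monomial_scaled_single:
  "(\<Sum>i\<in>keys m. of_nat (lookup m i) * single i 1) = (m :: nat \<Rightarrow>\<^sub>0 nat)"
  by (rule poly_mapping_eqI)
    (simp add: of_nat_mult_single[unfolded One_nat_def] lookup_sum lookup_single when_def in_keys_iff)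

section \<open>Substitution of monomials for the variables\<close>

definition msubst :: "(nat \<Rightarrow> (nat \<Rightarrow>\<^sub>0 nat)) \<Rightarrow> (nat \<Rightarrow>\<^sub>0 nat) \<Rightarrow> (nat \<Rightarrow>\<^sub>0 nat)" where
  "msubst h m = (\<Sum>i\<in>keys m. of_nat (lookup m i) * h i)"

lemma lookup_msubst: "lookup (msubst h m) j = (\<Sum>i\<in>keys m. lookup m i * lookup (h i) j)"
  by (simp add: msubst_def lookup_sum lookup_of_nat_mult)

text \<open>Replacing each variable by a monomial only changes the weight of every object, from
  \<open>f x\<close> to \<open>msubst h (f x)\<close>. Finiteness is required of the new weight,
  because many old monomials may collapse to one.\<close>

lemma subst_gf_monomial:
  assumes "finite_fibres S (\<lambda>x. msubst h (f x))"
  shows "mfps_subst (gf S f) (\<lambda>i. monomial (h i)) = (gf S (\<lambda>x. msubst h (f x)) :: 'a::comm_ring_1 mfps)"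
proof (rule mfps_eqI)
  fix n
  let ?X = "{x \<in> S. msubst h (f x) = n}"
  let ?c = "\<lambda>m. of_nat (card {x \<in> S. f x = m}) * mcoeff (monomial (msubst h m) :: 'a mfps) n"
  have fin: "finite ?X" using assms by (rule finite_fibresD)
  have "mcoeff (mfps_subst (gf S f) (\<lambda>i. monomial (h i)) :: 'a mfps) n = (\<Sum>m | ?c m \<noteq> 0. ?c m)"
    by (simp add: mfps_subst_def mfps_Sum_def monomial_power monomial_sum msubst_def)
  \<comment> \<open>A term survives only if \<open>m\<close> is the old weight of an object whose
    new weight is \<open>n\<close>; this leaves a finite sum.\<close>
  also have "\<dots> = (\<Sum>m\<in>f ` ?X. ?c m)"
  proof (rule sum.mono_neutral_left)
    show "{m. ?c m \<noteq> 0} \<subseteq> f ` ?X"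
    proof
      fix m assume "m \<in> {m. ?c m \<noteq> 0}"
      then have "n = msubst h m" "card {x \<in> S. f x = m} \<noteq> 0"
        by (auto split: if_splits intro: ccontr)
      moreover from this obtain x where "x \<in> S" "f x = m"
        by (metis (mono_tags, lifting) card.empty empty_Collect_eq)
      ultimately show "m \<in> f ` ?X" by auto
    qed
  qed (use fin in auto)
  \<comment> \<open>For such \<open>m\<close> the whole fibre of \<open>f\<close> over
    \<open>m\<close> lies in \<open>?X\<close>, so the terms are the sizes of the blocks of a
    partition of \<open>?X\<close>.\<close>
  also have "\<dots> = (\<Sum>m\<in>f ` ?X. of_nat (card {x \<in> ?X. f x = m}))"
  proof (rule sum.cong[OF refl])
    fix m assume "m \<in> f ` ?X"
    then have "n = msubst h m" "{x \<in> ?X. f x = m} = {x \<in> S. f x = m}" by auto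
    then show "?c m = of_nat (card {x \<in> ?X. f x = m})" by simp
  qed
  also have "\<dots> = of_nat (card ?X)"
    unfolding of_nat_sum[symmetric]
    using sum.group[OF fin finite_imageI[OF fin] subset_refl, where g = f and h = "\<lambda>_. 1 :: nat"]
    by (simp del: of_nat_sum)
  finally show "mcoeff (mfps_subst (gf S f) (\<lambda>i. monomial (h i))) n
      = mcoeff (gf S (\<lambda>x. msubst h (f x)) :: 'a mfps) n"
    by simp
qed

text \<open>The image of the first variable carries a sign and is no \<open>monomial\<close>, so
  this substitution is treated separately. It multiplies each monomial by a sign, hence only
  \<open>m = n\<close> contributes to the coefficient of \<open>n\<close>.\<close>

lemma subst_neg_first:
  "mcoeff (mfps_subst F (\<lambda>i. if i = 1 then - mvar 1 else mvar i)) n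
     = (- 1) ^ lookup n 1 * mcoeff F n"
proof -
  let ?g = "\<lambda>i. if i = 1 then - mvar 1 else mvar i :: 'a mfps"
  have g: "?g i ^ k = (if i = 1 then (- 1) ^ k else 1) * monomial (of_nat k * single i 1)" for i k
    by (simp add: mvar_eq_monomial monomial_power power_minus[of "monomial _"])
  have sgn: "mcoeff ((- 1) ^ k * H) n = (- 1) ^ k * mcoeff H n" for k and H :: "'a mfps"
    by (induction k) simp_all
  have "(\<Prod>i\<in>keys m. ?g i ^ lookup m i) = (- 1) ^ lookup m 1 * monomial m" for m
  proof -
    have "(\<Prod>i\<in>keys m. (if i = 1 then (- 1) ^ lookup m i else 1 :: 'a mfps)) = (- 1) ^ lookup m 1"
      by (simp add: in_keys_iff)
    then show ?thesis
      unfolding g prod.distrib monomial_sum monomial_scaled_single by simp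
  qed
  then have "mcoeff (mfps_subst F ?g) n = (\<Sum>m | mcoeff F m * ((- 1) ^ lookup m 1 *
      (if n = m then 1 else 0)) \<noteq> 0. mcoeff F m * ((- 1) ^ lookup m 1 * (if n = m then 1 else 0)))"
    by (simp add: mfps_subst_def mfps_Sum_def sgn)
  also have "\<dots> = (\<Sum>m\<in>{n}. mcoeff F m * ((- 1) ^ lookup m 1 * (if n = m then 1 else 0)))"
    by (rule sum.mono_neutral_left) (auto split: if_splits)
  finally show ?thesis by (simp add: mult.commute)
qed

section \<open>Increasing subsequences\<close>

text \<open>The predicate is arbitrary so that recursion along the list can absorb a chosen letter
  into it.\<close>

definition count_subseqs :: "('a list \<Rightarrow> bool) \<Rightarrow> 'a list \<Rightarrow> nat" where
  "count_subseqs P w = card {I. I \<subseteq> {..<length w} \<and> P (nths w I)}"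

lemma count_subseqs_Nil: "count_subseqs P [] = (if P [] then 1 else 0)"
proof -
  have "{I. I \<subseteq> {..<length ([] :: 'a list)} \<and> P (nths ([] :: 'a list) I)} = (if P [] then {{}} else {})"
    by auto
  then show ?thesis by (simp add: count_subseqs_def)
qed

text \<open>Position sets are sorted by whether they contain 0, that is, whether \<open>x\<close> is
  chosen.\<close>

lemma count_subseqs_Cons:
  "count_subseqs P (x # w) = count_subseqs (\<lambda>u. P (x # u)) w + count_subseqs P w"
proof -
  let ?A = "{I. I \<subseteq> {..<length w} \<and> P (x # nths w I)}"
  let ?B = "{I. I \<subseteq> {..<length w} \<and> P (nths w I)}"
  have fin: "finite ?A" "finite ?B"
    by (rule finite_subset[of _ "Pow {..<length w}"]; auto)+
  \<comment> \<open>The map sending \<open>I\<close> to \<open>{j. Suc j \<in> I}\<close> inverts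
    both ways of lifting a position set; it is also the one in \<open>nths_Cons\<close>.\<close>
  have S: "{j. Suc j \<in> Suc ` I} = I" "{j. Suc j \<in> insert 0 (Suc ` I)} = I" for I by auto
  have *: "I = (if 0 \<in> I then insert 0 (Suc ` {j. Suc j \<in> I}) else Suc ` {j. Suc j \<in> I})" for I
  proof (rule set_eqI)
    fix k show "k \<in> I \<longleftrightarrow> k \<in> (if 0 \<in> I then insert 0 (Suc ` {j. Suc j \<in> I}) else Suc ` {j. Suc j \<in> I})"
      by (cases k) auto
  qed
  have "{I. I \<subseteq> {..<length (x # w)} \<and> P (nths (x # w) I)}
      = (\<lambda>I. insert 0 (Suc ` I)) ` ?A \<union> (`) Suc ` ?B" (is "?L = ?R")
  proof
    show "?R \<subseteq> ?L" by (auto simp: nths_Cons S)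
    show "?L \<subseteq> ?R"
    proof
      fix I assume I: "I \<in> ?L"
      let ?J = "{j. Suc j \<in> I}"
      have J: "?J \<subseteq> {..<length w}" using I by auto
      have nths: "nths (x # w) I = (if 0 \<in> I then [x] else []) @ nths w ?J"
        by (rule nths_Cons)
      show "I \<in> ?R"
      proof (cases "0 \<in> I")
        case True
        have "?J \<in> ?A" using I J nths True by simp
        moreover have "I = insert 0 (Suc ` ?J)" using *[of I] True by presburger
        ultimately show ?thesis by (intro UnI1 image_eqI)
      next
        case False
        have "?J \<in> ?B" using I J nths False by simp
        moreover have "I = Suc ` ?J" using *[of I] False by presburger
        ultimately show ?thesis by (intro UnI2 image_eqI)
      qed
    qed
  qed
  moreover have "card ?R = card ((\<lambda>I. insert 0 (Suc ` I)) ` ?A) + card ((`) Suc ` ?B)"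
    using fin by (intro card_Un_disjoint) auto
  moreover have "card ((\<lambda>I. insert 0 (Suc ` I)) ` ?A) = card ?A"
    by (rule card_image, rule inj_on_inverseI[where g = "\<lambda>I. {j. Suc j \<in> I}"]) (rule S)
  moreover have "card ((`) Suc ` ?B) = card ?B"
    by (rule card_image, rule inj_on_inverseI[where g = "\<lambda>I. {j. Suc j \<in> I}"]) (rule S)
  ultimately show ?thesis by (simp add: count_subseqs_def)
qed

lemma count_subseqs_snoc:
  "count_subseqs P (w @ [x]) = count_subseqs (\<lambda>u. P (u @ [x])) w + count_subseqs P w"
  by (induction w arbitrary: P) (simp_all add: count_subseqs_Nil count_subseqs_Cons)

lemma count_subseqs_False: "count_subseqs (\<lambda>_. False) w = 0"
  by (simp add: count_subseqs_def)

text \<open>Letters of \<open>v\<close> are removed from the right: choosing one makes the predicate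
  constantly false, so its summand in \<open>count_subseqs_snoc\<close> vanishes.\<close>

lemma count_subseqs_append_irrelevant:
  assumes "\<And>u y. y \<in> set v \<Longrightarrow> y \<in> set u \<Longrightarrow> \<not> P u"
  shows "count_subseqs P (w @ v) = count_subseqs P w"
  using assms
proof (induction v rule: rev_induct)
  case (snoc y v)
  have "\<not> P (u @ [y])" for u by (rule snoc.prems[of y]) simp_all
  then have "(\<lambda>u. P (u @ [y])) = (\<lambda>_. False)" by simp
  moreover have "count_subseqs P (w @ v) = count_subseqs P w"
    by (rule snoc.IH, rule snoc.prems) simp_all
  ultimately show ?case
    by (simp add: count_subseqs_snoc count_subseqs_False flip: append_assoc)
qed simp

section \<open>Increasing patterns and the weight of a permutation\<close>

definition incr :: "nat \<Rightarrow> nat list \<Rightarrow> bool" where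
  "incr j u \<longleftrightarrow> length u = j \<and> sorted_wrt (<) u"

text \<open>Entries of \<open>[1..<j + 1]\<close> compare like their indices, so order isomorphism
  to this list means being strictly increasing.\<close>

lemma order_isomorphic_incr: "order_isomorphic u [1..<j + 1] \<longleftrightarrow> incr j u"
proof -
  have "(\<forall>a<j. \<forall>b<j. u ! a < u ! b \<longleftrightarrow> a < b) \<longleftrightarrow> (\<forall>a b. a < b \<longrightarrow> b < j \<longrightarrow> u ! a < u ! b)"
    (is "?L \<longleftrightarrow> ?R")
  proof
    show ?R if ?L using that by auto
  next
    assume R: ?R
    show ?L
    proof (intro allI impI)
      fix a b assume "a < j" "b < j"
      then show "u ! a < u ! b \<longleftrightarrow> a < b"
        using R[rule_format, of a b] R[rule_format, of b a] by (cases a b rule: linorder_cases) auto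
    qed
  qed
  moreover have "order_isomorphic u [1..<j + 1] \<longleftrightarrow>
      length u = j \<and> (\<forall>a<j. \<forall>b<j. u ! a < u ! b \<longleftrightarrow> a < b)"
    by (auto simp: order_isomorphic_def simp del: upt_Suc)
  ultimately show ?thesis
    by (auto simp: incr_def sorted_wrt_iff_nth_less)
qed

definition occ_incr :: "nat \<Rightarrow> nat list \<Rightarrow> nat" where
  "occ_incr j w = count_subseqs (incr j) w"

lemma occurrences_incr: "occurrences [1..<j + 1] w = occ_incr j w"
  by (simp only: occurrences_def order_isomorphic_incr occ_incr_def count_subseqs_def)

lemma occ_incr_0: "occ_incr 0 w = 1"
proof -
  have "incr 0 = (\<lambda>u. u = [])" by (auto simp: incr_def)
  moreover have "count_subseqs (\<lambda>u. u = []) w = 1"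
    by (induction w) (simp_all add: count_subseqs_Nil count_subseqs_Cons count_subseqs_False)
  ultimately show ?thesis by (simp add: occ_incr_def)
qed

lemma occ_incr_1: "occ_incr 1 w = length w"
proof (induction w)
  case Nil
  then show ?case by (simp add: occ_incr_def count_subseqs_Nil incr_def)
next
  case (Cons x w)
  have "(\<lambda>u. incr 1 (x # u)) = incr 0" by (auto simp: incr_def fun_eq_iff)
  then show ?case using Cons occ_incr_0[of w] by (simp add: occ_incr_def count_subseqs_Cons)
qed

lemma occ_incr_eq_0: "length w < j \<Longrightarrow> occ_incr j w = 0"
proof -
  assume "length w < j"
  then have "\<not> incr j (nths w I)" for I
    using length_nths[of w I] card_mono[of "{..<length w}" "{i. i < length w \<and> i \<in> I}"]
    by (simp add: incr_def subset_iff)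
  then show ?thesis by (simp add: occ_incr_def count_subseqs_def)
qed

lemma occ_incr_map:
  assumes "strict_mono f"
  shows "occ_incr j (map f w) = occ_incr j w"
  using assms
  by (simp add: occ_incr_def count_subseqs_def nths_map incr_def sorted_wrt_map strict_mono_less)

text \<open>Deleting the final \<open>x\<close> matches the increasing subsequences of length
  \<open>Suc j\<close> that use it with those of length \<open>j\<close> in \<open>w\<close>;
  conversely \<open>x\<close> extends any of the latter, being larger than all entries.\<close>

lemma occ_incr_snoc:
  assumes "\<And>a. a \<in> set w \<Longrightarrow> a < x"
  shows "occ_incr (Suc j) (w @ [x]) = occ_incr (Suc j) w + occ_incr j w"
proof -
  have "count_subseqs (\<lambda>u. incr (Suc j) (u @ [x])) w = count_subseqs (incr j) w"
    unfolding count_subseqs_def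
    by (rule arg_cong[where f = card])
      (use assms in \<open>auto simp: incr_def sorted_wrt_append dest!: in_set_nthsD\<close>)
  then show ?thesis by (simp add: occ_incr_def count_subseqs_snoc)
qed

text \<open>No increasing subsequence can pass from \<open>w\<close> down to \<open>v\<close>. For
  \<open>j = 0\<close> the right side would count the empty subsequence twice.\<close>

lemma occ_incr_append:
  assumes "\<And>a b. a \<in> set w \<Longrightarrow> b \<in> set v \<Longrightarrow> b < a" "j > 0"
  shows "occ_incr j (w @ v) = occ_incr j w + occ_incr j v"
  using assms
proof (induction w)
  case Nil
  then show ?case by (simp add: occ_incr_def count_subseqs_Nil incr_def)
next
  case (Cons x w)
  have "count_subseqs (\<lambda>u. incr j (x # u)) (w @ v) = count_subseqs (\<lambda>u. incr j (x # u)) w"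
  proof (rule count_subseqs_append_irrelevant)
    fix u y assume "y \<in> set v" "y \<in> set u"
    then show "\<not> incr j (x # u)" using Cons.prems(1)[of x y] by (force simp: incr_def)
  qed
  then show ?case using Cons by (simp add: occ_incr_def count_subseqs_Cons)
qed

text \<open>The exponent of the monomial that \<open>w\<close> contributes to the generating
  function. Longer patterns do not fit into \<open>w\<close>, so \<open>lookup_wt\<close> holds for
  every index.\<close>

definition wt :: "nat list \<Rightarrow> (nat \<Rightarrow>\<^sub>0 nat)" where
  "wt w = (\<Sum>j = 1..length w. single j (occ_incr j w))"

lemma lookup_wt: "lookup (wt w) j = (if j = 0 then 0 else occ_incr j w)"
  by (auto simp: wt_def lookup_sum lookup_single when_def occ_incr_eq_0)

lemma lookup_wt_1: "lookup (wt w) 1 = length w"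
  by (simp add: lookup_wt occ_incr_1[unfolded One_nat_def])

lemma wt_Nil: "wt [] = 0"
  by (simp add: wt_def)

lemma wt_map: "strict_mono f \<Longrightarrow> wt (map f w) = wt w"
  by (rule poly_mapping_eqI) (simp add: lookup_wt occ_incr_map)

lemma wt_append:
  assumes "\<And>a b. a \<in> set w \<Longrightarrow> b \<in> set v \<Longrightarrow> b < a"
  shows "wt (w @ v) = wt w + wt v"
  using assms by (intro poly_mapping_eqI) (auto simp: lookup_wt lookup_add occ_incr_append)

definition shift1 :: "nat \<Rightarrow> (nat \<Rightarrow>\<^sub>0 nat)" where
  "shift1 i = single i 1 + single (i + 1) 1"

text \<open>The result of applying the substitution \<open>shift1\<close> twice to one
  variable.\<close>

definition shift2 :: "nat \<Rightarrow> (nat \<Rightarrow>\<^sub>0 nat)" where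
  "shift2 i = single i 1 + of_nat 2 * single (i + 1) 1 + single (i + 2) 1"

lemma lookup_msubst_shift1:
  "lookup (msubst shift1 m) j = lookup m j + (if j = 0 then 0 else lookup m (j - 1))"
proof -
  \<comment> \<open>Only the indices \<open>j\<close> and \<open>j - 1\<close> feed the exponent at
    \<open>j\<close>. The guard \<open>j \<noteq> 0\<close> is there because truncated subtraction
    would identify the two at 0.\<close>
  have "lookup (msubst shift1 m) j
      = (\<Sum>i\<in>keys m. (if i = j then lookup m i else 0) + (if j \<noteq> 0 \<and> i = j - 1 then lookup m i else 0))"
    unfolding lookup_msubst
    by (rule sum.cong) (auto simp: shift1_def lookup_add lookup_single when_def)
  then show ?thesis by (auto simp: sum.distrib in_keys_iff)
qed

lemma lookup_msubst_shift2:
  "lookup (msubst shift2 m) j = lookup m j + (if j = 0 then 0 else 2 * lookup m (j - 1))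
     + (if j < 2 then 0 else lookup m (j - 2))"
proof -
  have "lookup (msubst shift2 m) j
      = (\<Sum>i\<in>keys m. (if i = j then lookup m i else 0)
          + (if j \<noteq> 0 \<and> i = j - 1 then 2 * lookup m i else 0)
          + (if j \<ge> 2 \<and> i = j - 2 then lookup m i else 0))"
    unfolding lookup_msubst
    by (rule sum.cong) (auto simp: shift2_def lookup_add lookup_single when_def lookup_of_nat_mult
        simp del: of_nat_numeral)
  then show ?thesis by (auto simp: sum.distrib in_keys_iff)
qed

lemma wt_snoc:
  assumes "\<And>a. a \<in> set w \<Longrightarrow> a < x"
  shows "wt (w @ [x]) = single 1 1 + msubst shift1 (wt w)"
proof (rule poly_mapping_eqI)
  fix j
  \<comment> \<open>The index 1 is special: the new entry alone extends the empty pattern, for which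
    \<open>occ_incr 0\<close> is 1 while \<open>wt\<close> stores 0 at index 0. The term
    \<open>single 1 1\<close> makes up the difference.\<close>
  consider "j = 0" | "j = 1" | k where "j = Suc (Suc k)"
    by (metis One_nat_def not0_implies_Suc)
  then show "lookup (wt (w @ [x])) j = lookup (single 1 1 + msubst shift1 (wt w)) j"
    using occ_incr_snoc[OF assms, where j = "j - 1"]
    by cases (auto simp: lookup_add lookup_msubst_shift1 lookup_wt lookup_single occ_incr_0)
qed

text \<open>Appending a new maximum twice: the inner factor \<open>x\<^sub>1\<close> becomes
  \<open>x\<^sub>1 x\<^sub>2\<close> and meets the outer \<open>x\<^sub>1\<close>. This is the
  source of the factor \<open>x\<^sub>1\<^sup>2 x\<^sub>2\<close> in the denominator.\<close>

lemma msubst_shift1_shift1: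
  assumes "lookup m 0 = 0"
  shows "single 1 1 + msubst shift1 (single 1 1 + msubst shift1 m)
    = (single 1 2 + single 2 1) + msubst shift2 m"
proof (rule poly_mapping_eqI)
  fix j
  consider "j = 0" | "j = 1" | "j = 2" | k where "j = Suc (Suc (Suc k))"
    by (metis One_nat_def not0_implies_Suc numeral_2_eq_2)
  then show "lookup (single 1 1 + msubst shift1 (single 1 1 + msubst shift1 m)) j
    = lookup ((single 1 2 + single 2 1) + msubst shift2 m) j"
    using assms
    by cases (auto simp: lookup_add lookup_msubst_shift1 lookup_msubst_shift2 lookup_single when_def)
qed

section \<open>Decomposition of 132-avoiding Dumont permutations at the maximum\<close>

text \<open>Here \<open>a\<close>, \<open>b\<close>, \<open>c\<close> are named by size and listed
  in pattern order; phrasing avoidance by \<open>subseq\<close> makes it easy to split along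
  \<open>@\<close>.\<close>

definition avoids132 :: "nat list \<Rightarrow> bool" where
  "avoids132 w \<longleftrightarrow> (\<forall>a b c. subseq [a, c, b] w \<longrightarrow> a < b \<longrightarrow> \<not> b < c)"

lemma order_isomorphic_132:
  "order_isomorphic u [1, 3, 2] \<longleftrightarrow> (\<exists>a b c. u = [a, c, b] \<and> a < b \<and> b < c)"
proof (cases "length u = 3")
  case True
  then obtain a c b where "u = [a, c, b]"
    by (metis (no_types, opaque_lifting) length_0_conv length_Suc_conv numeral_3_eq_3)
  then show ?thesis
    by (auto simp: order_isomorphic_def All_less_Suc numeral_3_eq_3)
qed (auto simp: order_isomorphic_def)

lemma occurrences_132_eq_0: "occurrences [1, 3, 2] w = 0 \<longleftrightarrow> avoids132 w"
proof -
  have "finite {I. I \<subseteq> {..<length w} \<and> order_isomorphic (nths w I) [1, 3, 2]}"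
    by (rule finite_subset[of _ "Pow {..<length w}"]) auto
  then have "occurrences [1, 3, 2] w = 0 \<longleftrightarrow>
      (\<forall>I. I \<subseteq> {..<length w} \<longrightarrow> \<not> order_isomorphic (nths w I) [1, 3, 2])"
    unfolding occurrences_def by auto
  also have "\<dots> \<longleftrightarrow> (\<forall>I. \<not> order_isomorphic (nths w I) [1, 3, 2])"
  proof -
    have "nths w I = nths w (I \<inter> {..<length w})" for I
      unfolding nths_def by (rule arg_cong[where f = "map fst"], rule filter_cong)
        (auto simp: set_zip)
    then show ?thesis by (metis inf_le2)
  qed
  also have "\<dots> \<longleftrightarrow> avoids132 w"
    unfolding order_isomorphic_132 avoids132_def subseq_conv_nths by metis
  finally show ?thesis .
qed

lemma three_eq_append:
  "[a, c, b] = xs @ ys \<longleftrightarrow> xs = [] \<and> ys = [a, c, b] \<or> xs = [a] \<and> ys = [c, b]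
     \<or> xs = [a, c] \<and> ys = [b] \<or> xs = [a, c, b] \<and> ys = []"
  by (cases xs; cases "tl xs"; cases "tl (tl xs)") auto

lemma subseq_set_subset: "subseq xs ys \<Longrightarrow> set xs \<subseteq> set ys"
  by (auto simp: subseq_conv_nths dest: in_set_nthsD)

text \<open>An occurrence of 132 across the boundary would have its first letter in \<open>u\<close>
  and its last in \<open>v\<close>, but the first is the smaller of the two.\<close>

lemma avoids132_append:
  assumes "\<And>a b. a \<in> set u \<Longrightarrow> b \<in> set v \<Longrightarrow> b < a"
  shows "avoids132 (u @ v) \<longleftrightarrow> avoids132 u \<and> avoids132 v"
proof
  assume "avoids132 (u @ v)"
  then show "avoids132 u \<and> avoids132 v"
    unfolding avoids132_def by (blast intro: subseq_drop_many subseq_rev_drop_many)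
next
  assume uv: "avoids132 u \<and> avoids132 v"
  show "avoids132 (u @ v)"
    unfolding avoids132_def
  proof (intro allI impI notI)
    fix a b c assume sub: "subseq [a, c, b] (u @ v)" and ab: "a < b" and bc: "b < c"
    from sub obtain xs ys where xy: "[a, c, b] = xs @ ys" "subseq xs u" "subseq ys v"
      by (rule subseq_appendE)
    have sub: "set xs \<subseteq> set u" "set ys \<subseteq> set v"
      using xy(2,3) by (auto dest: subseq_set_subset)
    from xy(1) consider "xs = []" "ys = [a, c, b]" | "xs = [a]" "ys = [c, b]"
      | "xs = [a, c]" "ys = [b]" | "xs = [a, c, b]" "ys = []"
      unfolding three_eq_append by blast
    then show False
    proof cases
      case 1
      then show False using uv xy(3) ab bc unfolding avoids132_def by blast
    next
      case 2
      then show False using sub assms[of a c] ab bc by auto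
    next
      case 3
      then show False using sub assms[of a b] ab by auto
    next
      case 4
      then show False using uv xy(2) ab bc unfolding avoids132_def by blast
    qed
  qed
qed

text \<open>An occurrence using the final maximum would use it as last letter, yet the last letter
  of 132 is not the largest.\<close>

lemma avoids132_snoc:
  assumes "\<And>a. a \<in> set u \<Longrightarrow> a < x" "avoids132 u"
  shows "avoids132 (u @ [x])"
  unfolding avoids132_def
proof (intro allI impI notI)
  fix a b c assume sub: "subseq [a, c, b] (u @ [x])" and ab: "a < b" and bc: "b < c"
  from sub obtain xs ys where xy: "[a, c, b] = xs @ ys" "subseq xs u" "subseq ys [x]"
    by (rule subseq_appendE)
  have sub: "set xs \<subseteq> set u" "set ys \<subseteq> {x}"
    using subseq_set_subset[OF xy(2)] subseq_set_subset[OF xy(3)] by simp_all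
  from xy(1) consider "xs = []" "ys = [a, c, b]" | "xs = [a]" "ys = [c, b]"
    | "xs = [a, c]" "ys = [b]" | "xs = [a, c, b]" "ys = []"
    unfolding three_eq_append by blast
  then show False
  proof cases
    case 3
    then show False using sub assms(1)[of c] bc by auto
  next
    case 4
    then show False using assms(2) xy(2) ab bc unfolding avoids132_def by blast
  qed (use sub ab bc in auto)
qed

lemma avoids132_map:
  assumes "strict_mono f"
  shows "avoids132 (map f w) \<longleftrightarrow> avoids132 w"
proof -
  have "subseq [x, z, y] (map f w) \<longleftrightarrow>
      (\<exists>a b c. subseq [a, c, b] w \<and> x = f a \<and> y = f b \<and> z = f c)" for x y z
  proof
    assume "subseq [x, z, y] (map f w)"
    then obtain I where I: "map f (nths w I) = [x, z, y]"
      unfolding subseq_conv_nths nths_map by metis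
    then have "\<exists>a b c. nths w I = [a, c, b] \<and> x = f a \<and> y = f b \<and> z = f c"
      by (auto simp: map_eq_Cons_conv)
    then show "\<exists>a b c. subseq [a, c, b] w \<and> x = f a \<and> y = f b \<and> z = f c"
      unfolding subseq_conv_nths by metis
  qed (auto dest: subseq_map[of _ _ f])
  then have "avoids132 (map f w) \<longleftrightarrow>
      (\<forall>x y z. (\<exists>a b c. subseq [a, c, b] w \<and> x = f a \<and> y = f b \<and> z = f c) \<longrightarrow>
        x < y \<longrightarrow> \<not> y < z)"
    unfolding avoids132_def by simp
  also have "\<dots> \<longleftrightarrow> (\<forall>a b c. subseq [a, c, b] w \<longrightarrow> f a < f b \<longrightarrow> \<not> f b < f c)"
    by blast
  finally show ?thesis
    using assms by (simp add: avoids132_def strict_mono_less)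
qed

section \<open>The Dumont condition\<close>

lemma dumont_Nil: "dumont []"
  by (simp add: dumont_def)

lemma dumont_Cons:
  "dumont (x # w) \<longleftrightarrow>
     (if even x then w \<noteq> [] \<and> hd w < x else w = [] \<or> x < hd w) \<and> dumont w"
  unfolding dumont_def length_Cons All_less_Suc2
  by (cases w) auto

text \<open>The last letter of \<open>u\<close> must be odd on either side: in \<open>u\<close>
  because nothing follows it, in the concatenation because the larger \<open>y\<close> does.\<close>

lemma dumont_append_larger:
  assumes "\<And>a. a \<in> set u \<Longrightarrow> a < y"
  shows "dumont (u @ y # v) \<longleftrightarrow> dumont u \<and> dumont (y # v)"
  using assms
proof (induction u)
  case Nil
  then show ?case by (simp add: dumont_Nil)
next
  case (Cons x u)
  have IH: "dumont (u @ y # v) \<longleftrightarrow> dumont u \<and> dumont (y # v)" using Cons by simp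
  have "x < y" using Cons.prems by simp
  then show ?case
    unfolding append_Cons dumont_Cons[of x] IH by (cases u) auto
qed

text \<open>An even shift preserves parities as well as comparisons.\<close>

lemma dumont_shift_even:
  assumes "even k"
  shows "dumont (map ((+) k) w) \<longleftrightarrow> dumont w"
proof (induction w)
  case (Cons x w)
  then show ?case using assms by (cases w) (simp_all add: dumont_Cons)
qed simp

text \<open>An even letter is followed by a smaller one, which is impossible for the least
  letter.\<close>

lemma dumont_min_odd:
  assumes "dumont w" "x \<in> set w" "\<And>y. y \<in> set w \<Longrightarrow> x \<le> y"
  shows "odd x"
  using assms
proof (induction w)
  case (Cons z w)
  show ?case
  proof (cases "x \<in> set w")
    case True
    then show ?thesis using Cons by (simp add: dumont_Cons)
  next
    case False
    then have "x = z" using Cons.prems(2) by simp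
    show ?thesis
    proof
      assume "even x"
      then have "w \<noteq> []" "hd w < x" using Cons.prems(1) \<open>x = z\<close> by (auto simp: dumont_Cons)
      moreover have "x \<le> hd w" using Cons.prems(3) \<open>w \<noteq> []\<close> by simp
      ultimately show False by simp
    qed
  qed
qed simp

lemma dumont132_iff:
  "w \<in> dumont132 \<longleftrightarrow> distinct w \<and> set w = {1..length w} \<and> dumont w \<and> avoids132 w"
proof -
  have "w \<in> permutations_of_set {1..n} \<longleftrightarrow> distinct w \<and> set w = {1..n}" for n
    by (auto simp: permutations_of_set_def)
  moreover have "length w = n" if "distinct w" "set w = {1..n}" for n
    using that distinct_card[of w] by simp
  ultimately show ?thesis
    unfolding dumont132_def mem_Collect_eq occurrences_132_eq_0 by blast
qed

lemma Nil_in_dumont132: "[] \<in> dumont132"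
  by (simp add: dumont132_iff dumont_Nil avoids132_def)

section \<open>Joining two permutations around a new maximum\<close>

definition join :: "nat list \<Rightarrow> nat list \<Rightarrow> nat list" where
  "join u v = map ((+) (length v)) u @ (length u + length v + 1) # v"

lemma length_join: "length (join u v) = length u + length v + 1"
  by (simp add: join_def)

text \<open>If \<open>u\<close> is non-empty, its least shifted entry is
  \<open>length v + 1\<close>, which must be odd. The last clause says that the maximum
  \<open>length u + length v + 1\<close> is odd exactly when nothing follows it.\<close>

definition joinable :: "nat list \<Rightarrow> nat list \<Rightarrow> bool" where
  "joinable u v \<longleftrightarrow> u \<in> dumont132 \<and> v \<in> dumont132 \<and> (u = [] \<or> even (length v)) \<and>
     (v = [] \<longleftrightarrow> even (length u + length v))"

lemma join_bounds:
  assumes "u \<in> dumont132" "v \<in> dumont132"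
  shows "set (map ((+) (length v)) u) = {length v + 1..length u + length v}"
    and "set v = {1..length v}"
proof -
  have "set u = {1..length u}" using assms by (simp add: dumont132_iff)
  then have "set (map ((+) (length v)) u) = (+) (length v) ` {1..length u}" by simp
  also have "\<dots> = {length v + 1..length u + length v}"
    unfolding image_add_atLeastAtMost by (simp add: add.commute)
  finally show "set (map ((+) (length v)) u) = {length v + 1..length u + length v}" .
  show "set v = {1..length v}" using assms by (simp add: dumont132_iff)
qed

lemma join_in_dumont132:
  assumes "joinable u v"
  shows "join u v \<in> dumont132"
proof -
  let ?u = "map ((+) (length v)) u" and ?n = "length u + length v + 1"
  have uv: "u \<in> dumont132" "v \<in> dumont132" using assms by (auto simp: joinable_def)
  note sets = join_bounds[OF uv]
  have lt: "a < ?n" if "a \<in> set ?u" for a using that unfolding sets by simp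
  have gt: "b < a" if "a \<in> set (?u @ [?n])" "b \<in> set v" for a b
    using that unfolding set_append sets by auto
  have "distinct (join u v)"
    using uv sets unfolding join_def dumont132_iff by (auto simp: distinct_map)
  moreover have "set (join u v) = {1..length (join u v)}"
    unfolding length_join unfolding join_def set_append list.set sets by auto
  moreover have "dumont (join u v)"
  proof -
    have "dumont ?u"
      using assms by (auto simp: joinable_def dumont_Nil dumont_shift_even dumont132_iff)
    \<comment> \<open>By the parity clause of \<open>joinable\<close>, the maximum is odd if it
      comes last and even if it is followed by \<open>hd v\<close>, which is smaller.\<close>
    moreover have "dumont (?n # v)"
    proof (cases "v = []")
      case True
      then show ?thesis using assms by (auto simp: joinable_def dumont_Cons dumont_Nil)
    next
      case False
      then have "hd v \<in> {1..length v}" using sets(2) hd_in_set by metis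
      then show ?thesis
        using assms False by (auto simp: joinable_def dumont_Cons dumont132_iff)
    qed
    ultimately show ?thesis
      unfolding join_def using dumont_append_larger[OF lt] by blast
  qed
  moreover have "avoids132 (join u v)"
  proof -
    have "avoids132 ?u"
      using uv by (subst avoids132_map) (auto simp: strict_mono_def dumont132_iff)
    then have "avoids132 (?u @ [?n])" by (rule avoids132_snoc[rotated]) (rule lt)
    moreover have "avoids132 ((?u @ [?n]) @ v) \<longleftrightarrow> avoids132 (?u @ [?n]) \<and> avoids132 v"
      by (rule avoids132_append) (rule gt)
    ultimately have "avoids132 ((?u @ [?n]) @ v)"
      using uv(2) unfolding dumont132_iff by blast
    then show ?thesis by (simp add: join_def)
  qed
  ultimately show ?thesis by (simp add: dumont132_iff)
qed

text \<open>The length fixes the maximum, which occurs only once, so its position determines both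
  blocks. Equal lower blocks give equal shifts, and a shift is injective.\<close>

lemma join_inject:
  assumes "u \<in> dumont132" "v \<in> dumont132" "join u v = join u' v'"
  shows "u = u' \<and> v = v'"
proof -
  let ?u = "map ((+) (length v)) u" and ?n = "length u + length v + 1"
  have n: "?n = length u' + length v' + 1" using assms(3) length_join by metis
  have "?n \<notin> set ?u" "?n \<notin> set v" unfolding join_bounds[OF assms(1,2)] by auto
  moreover have "?u @ ?n # v = map ((+) (length v')) u' @ ?n # v'"
    using assms(3) unfolding join_def n .
  ultimately have "?u = map ((+) (length v')) u' \<and> v = v'"
    by (subst (asm) append_Cons_eq_iff) auto
  then show ?thesis by (auto dest: map_injective)
qed

text \<open>A number in the interval below \<open>Max B\<close> cannot lie in \<open>A\<close>,
  whose elements exceed \<open>Max B\<close>; hence \<open>B\<close> has no gaps.\<close>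

lemma lower_part_initial_segment:
  fixes A B :: "nat set"
  assumes "A \<union> B = {1..n}" "\<And>a b. a \<in> A \<Longrightarrow> b \<in> B \<Longrightarrow> b < a"
  shows "B = {1..card B}" "A = {card B + 1..n}"
proof -
  have "\<exists>k. B = {1..k}"
  proof (cases "B = {}")
    case False
    have fin: "finite B" using assms(1) by (metis finite_Un finite_atLeastAtMost)
    have "B = {1..Max B}"
    proof
      show "B \<subseteq> {1..Max B}" using assms(1) fin by fastforce
      show "{1..Max B} \<subseteq> B"
      proof
        fix y assume y: "y \<in> {1..Max B}"
        have M: "Max B \<in> B" using fin False by simp
        then have "Max B \<le> n" using assms(1) by auto
        then have "y \<in> A \<union> B" unfolding assms(1) using y by simp
        then show "y \<in> B" using assms(2)[OF _ M, of y] y by auto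
      qed
    qed
    then show ?thesis ..
  qed auto
  then show B: "B = {1..card B}" by auto
  have "A \<inter> B = {}" using assms(2) by blast
  then have "A = {1..n} - {1..card B}" using assms(1) B by auto
  then show "A = {card B + 1..n}" by auto
qed

text \<open>The converse of \<open>join_in_dumont132\<close>: cutting at the maximum and lowering
  the left block recovers a joinable pair.\<close>

lemma dumont132_join_cases:
  assumes w: "w \<in> dumont132" "w \<noteq> []"
  shows "\<exists>u v. joinable u v \<and> w = join u v"
proof -
  define n where "n = length w"
  have n: "n > 0" using w(2) by (simp add: n_def)
  have dist: "distinct w" and set: "set w = {1..n}" and dum: "dumont w" and av: "avoids132 w"
    using w(1) by (auto simp: dumont132_iff n_def)
  have "n \<in> set w" using set n by auto
  then obtain a v where avw: "w = a @ n # v" by (meson split_list)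
  have sets: "set a \<union> set v = {1..n - 1}"
  proof -
    have "set a \<union> set v = set w - {n}" using dist avw by auto
    also have "\<dots> = {1..n - 1}" unfolding set using n by auto
    finally show ?thesis .
  qed
  \<comment> \<open>Otherwise \<open>x\<close>, \<open>n\<close>, \<open>y\<close> would form the
    pattern 132.\<close>
  have gt: "y < x" if "x \<in> set a" "y \<in> set v" for x y
  proof -
    have "subseq [x] a" "subseq [y] v" using that by (simp_all add: subseq_singleton_left)
    then have "subseq ([x] @ [n, y]) w"
      unfolding avw by (intro list_emb_append_mono) auto
    moreover have "y \<in> {1..n - 1}" using that sets by auto
    ultimately have "\<not> x < y"
      using av[unfolded avoids132_def, rule_format, of x n y] n by auto
    moreover have "x \<noteq> y" using that dist avw by auto
    ultimately show ?thesis by simp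
  qed
  define k where "k = length v"
  have card: "card (set v) = k" using dist avw by (simp add: distinct_card k_def)
  have seg: "set v = {1..k}" "set a = {k + 1..n - 1}"
    using lower_part_initial_segment[of "set a" "set v" "n - 1"] sets gt unfolding card by blast+
  have lt: "x < n" if "x \<in> set a" for x using that n unfolding seg(2) by auto
  have nk: "n = length a + k + 1" using arg_cong[OF avw, of length] by (simp add: n_def k_def)
  \<comment> \<open>The truncated subtraction loses nothing, since all entries of \<open>a\<close>
    are at least \<open>k + 1\<close>.\<close>
  define u where "u = map (\<lambda>x. x - k) a"
  have a: "a = map ((+) k) u"
    unfolding u_def map_map by (rule sym, rule map_idI) (use seg(2) in auto)
  have len: "length u = length a" by (simp add: u_def)
  have wj: "w = join u v"
    unfolding join_def avw len using a nk k_def by simp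
  have "dumont a" and nv: "dumont (n # v)"
    using dum dumont_append_larger[of a n v] lt unfolding avw by blast+
  \<comment> \<open>The least entry of \<open>a\<close> is \<open>k + 1\<close>, and the least entry
    of a Dumont word is odd.\<close>
  have keven: "even k" if "a \<noteq> []"
  proof -
    have "length a \<ge> 1" using that by (cases a) simp_all
    then have "k + 1 \<in> set a" using nk unfolding seg(2) by simp
    then have "odd (k + 1)"
      by (rule dumont_min_odd[OF \<open>dumont a\<close>]) (use seg(2) in auto)
    then show ?thesis by simp
  qed
  have "dumont u"
  proof (cases "a = []")
    case True
    then show ?thesis by (simp add: u_def dumont_Nil)
  next
    case False
    then show ?thesis using \<open>dumont a\<close> dumont_shift_even[OF keven, of u] a by metis
  qed
  have av_all: "avoids132 a" "avoids132 v"
  proof -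
    have "avoids132 ((a @ [n]) @ v)" using av avw by simp
    moreover have "avoids132 ((a @ [n]) @ v) \<longleftrightarrow> avoids132 (a @ [n]) \<and> avoids132 v"
      by (rule avoids132_append) (use gt seg(1) nk in auto)
    ultimately have "avoids132 (a @ [n])" "avoids132 v" by auto
    then show "avoids132 v" by blast
    from \<open>avoids132 (a @ [n])\<close> show "avoids132 a"
      unfolding avoids132_def by (blast intro: subseq_rev_drop_many)
  qed
  have "u \<in> dumont132"
  proof -
    have "distinct u" using dist a avw by (auto simp: distinct_map)
    moreover have "set u = {1..length u}"
    proof -
      have "set u = (\<lambda>x. x - k) ` {k + 1..length u + k}"
        using seg(2) nk len by (simp add: u_def)
      also have "\<dots> = {1..length u}"
        by (auto simp: image_iff intro!: bexI[of _ "_ + k"])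
      finally show ?thesis .
    qed
    moreover have "avoids132 u"
      using av_all(1) unfolding a by (subst (asm) avoids132_map) (auto simp: strict_mono_def)
    ultimately show ?thesis using \<open>dumont u\<close> by (simp add: dumont132_iff)
  qed
  moreover have "v \<in> dumont132"
    using dist avw seg(1) nv av_all(2) by (simp add: dumont132_iff dumont_Cons k_def)
  moreover have "u = [] \<or> even (length v)" using keven by (auto simp: k_def u_def)
  \<comment> \<open>The maximum \<open>n\<close> has the parity of
    \<open>length u + length v + 1\<close>. If odd, it cannot precede a smaller entry; if even, it
    cannot be last.\<close>
  moreover have "v = [] \<longleftrightarrow> even (length u + length v)"
  proof (cases "v = []")
    case True
    then show ?thesis using nv nk len by (auto simp: dumont_Cons k_def split: if_splits)
  next
    case False
    then have "hd v < n" using seg(1) nk hd_in_set[OF False] by auto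
    then show ?thesis using nv nk len False by (auto simp: dumont_Cons k_def split: if_splits)
  qed
  ultimately show ?thesis using wj unfolding joinable_def by blast
qed

section \<open>Permutations of even and odd size\<close>

definition evens :: "nat list set" where
  "evens = {w \<in> dumont132. even (length w)}"

definition odds :: "nat list set" where
  "odds = {w \<in> dumont132. odd (length w)}"

lemma odds_eq: "odds = (\<lambda>u. join u []) ` evens"
proof
  show "(\<lambda>u. join u []) ` evens \<subseteq> odds"
    using join_in_dumont132
    by (auto simp: evens_def odds_def length_join joinable_def Nil_in_dumont132)
  show "odds \<subseteq> (\<lambda>u. join u []) ` evens"
  proof
    fix w assume w: "w \<in> odds"
    then have "w \<in> dumont132" "w \<noteq> []" by (auto simp: odds_def)
    then obtain u v where uv: "joinable u v" "w = join u v" using dumont132_join_cases by blast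
    then have "v = []" "u \<in> evens"
      using w by (auto simp: odds_def evens_def length_join joinable_def)
    then show "w \<in> (\<lambda>u. join u []) ` evens" using uv(2) by blast
  qed
qed

text \<open>The two images separate empty from non-empty left blocks. In the second,
  \<open>[]\<close> is removed from \<open>evens\<close> because an even maximum needs a
  successor.\<close>

lemma evens_eq:
  "evens = {[]} \<union> (join [] ` odds \<union> (\<lambda>(u, v). join u v) ` (odds \<times> (evens - {[]})))"
proof
  have "join [] v \<in> evens" if "v \<in> odds" for v
    using that join_in_dumont132[of "[]" v] odd_pos
    by (fastforce simp: evens_def odds_def length_join joinable_def Nil_in_dumont132)
  moreover have "join u v \<in> evens" if "u \<in> odds" "v \<in> evens" "v \<noteq> []" for u v
    using that join_in_dumont132[of u v]
    by (auto simp: evens_def odds_def length_join joinable_def)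
  ultimately show "{[]} \<union> (join [] ` odds \<union> (\<lambda>(u, v). join u v) ` (odds \<times> (evens - {[]}))) \<subseteq> evens"
    by (auto simp: evens_def Nil_in_dumont132)
  show "evens \<subseteq> {[]} \<union> (join [] ` odds \<union> (\<lambda>(u, v). join u v) ` (odds \<times> (evens - {[]})))"
  proof
    fix w assume w: "w \<in> evens"
    show "w \<in> {[]} \<union> (join [] ` odds \<union> (\<lambda>(u, v). join u v) ` (odds \<times> (evens - {[]})))"
    proof (cases "w = []")
      case False
      then obtain u v where uv: "joinable u v" "w = join u v"
        using dumont132_join_cases[of w] w by (auto simp: evens_def)
      have "v \<noteq> []" using w uv by (auto simp: evens_def length_join joinable_def)
      show ?thesis
      proof (cases "u = []")
        case True
        then have "v \<in> odds"
          using w uv by (auto simp: evens_def odds_def length_join joinable_def)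
        then show ?thesis using True uv(2) by blast
      next
        case u: False
        then have "u \<in> odds" "v \<in> evens"
          using w uv by (auto simp: evens_def odds_def length_join joinable_def)
        then show ?thesis using \<open>v \<noteq> []\<close> uv(2) by auto
      qed
    qed simp
  qed
qed

section \<open>The functional equations\<close>

text \<open>The exponent of \<open>x\<^sub>1\<close> bounds the size, and there are only finitely
  many permutations of bounded size.\<close>

lemma finite_fibres_length:
  assumes "S \<subseteq> dumont132" "\<And>w. w \<in> S \<Longrightarrow> length w \<le> lookup (f w) 1"
  shows "finite_fibres S f"
  unfolding finite_fibres_def
proof
  fix m
  have "{w \<in> S. f w = m} \<subseteq> (\<Union>k\<le>lookup m 1. permutations_of_set {1..k})"
  proof
    fix w assume "w \<in> {w \<in> S. f w = m}"
    then have "w \<in> dumont132" "length w \<le> lookup m 1" using assms by auto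
    then show "w \<in> (\<Union>k\<le>lookup m 1. permutations_of_set {1..k})"
      by (auto simp: dumont132_iff permutations_of_set_def)
  qed
  then show "finite {w \<in> S. f w = m}" by (rule finite_subset) auto
qed

lemma evens_subset: "evens \<subseteq> dumont132" and odds_subset: "odds \<subseteq> dumont132"
  by (auto simp: evens_def odds_def)

lemma finite_fibres_wt: "S \<subseteq> dumont132 \<Longrightarrow> finite_fibres S wt"
  by (rule finite_fibres_length) (auto simp: lookup_wt_1[unfolded One_nat_def])

lemma finite_fibres_shift1: "S \<subseteq> dumont132 \<Longrightarrow> finite_fibres S (\<lambda>w. msubst shift1 (wt w))"
  by (rule finite_fibres_length)
    (auto simp: lookup_msubst_shift1 lookup_wt_1[unfolded One_nat_def])

lemma finite_fibres_shift2: "S \<subseteq> dumont132 \<Longrightarrow> finite_fibres S (\<lambda>w. msubst shift2 (wt w))"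
  by (rule finite_fibres_length)
    (auto simp: lookup_msubst_shift2 lookup_wt_1[unfolded One_nat_def])

lemma wt_join:
  assumes "u \<in> dumont132" "v \<in> dumont132"
  shows "wt (join u v) = single 1 1 + msubst shift1 (wt u) + wt v"
proof -
  let ?u = "map ((+) (length v)) u" and ?n = "length u + length v + 1"
  note sets = join_bounds[OF assms]
  have "wt (join u v) = wt ((?u @ [?n]) @ v)" by (simp add: join_def)
  also have "\<dots> = wt (?u @ [?n]) + wt v"
    by (rule wt_append) (unfold set_append sets, auto)
  also have "wt (?u @ [?n]) = single 1 1 + msubst shift1 (wt ?u)"
    by (rule wt_snoc) (unfold sets, auto)
  also have "wt ?u = wt u" by (rule wt_map) (simp add: strict_mono_def)
  finally show ?thesis .
qed

lemma msubst_0: "msubst h 0 = 0"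
  by (simp add: msubst_def)

text \<open>Stated for any weight \<open>f\<close>, because it is applied both to \<open>wt\<close>
  and to the weight of an odd-sized block followed by a new maximum.\<close>

lemma gf_odds:
  fixes f :: "nat list \<Rightarrow> (nat \<Rightarrow>\<^sub>0 nat)"
  shows "gf odds f = gf evens (\<lambda>u. f (join u []))"
  unfolding odds_eq
proof (rule gf_image)
  show "inj_on (\<lambda>u. join u []) evens"
    using join_inject evens_subset Nil_in_dumont132 unfolding inj_on_def by blast
qed

lemma wt_join_Nil: "u \<in> evens \<Longrightarrow> wt (join u []) = single 1 1 + msubst shift1 (wt u)"
  using wt_join[of u "[]"] evens_subset Nil_in_dumont132 by (auto simp: wt_Nil)

lemma gf_odds_wt:
  "gf odds wt = mvar 1 * gf evens (\<lambda>u. msubst shift1 (wt u))"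
proof -
  have "gf odds wt = gf evens (\<lambda>u. single 1 1 + msubst shift1 (wt u))"
    unfolding gf_odds by (rule gf_cong) (rule wt_join_Nil)
  then show ?thesis
    by (simp only: mvar_eq_monomial monomial_times_gf[OF finite_fibres_shift1[OF evens_subset]])
qed

text \<open>An odd-sized block is itself an even-sized one with a maximum appended, so a further
  maximum leads to the two-fold substitution.\<close>

lemma gf_odds_shift1:
  "gf odds (\<lambda>u. single 1 1 + msubst shift1 (wt u))
     = (mvar 1)\<^sup>2 * mvar 2 * gf evens (\<lambda>u. msubst shift2 (wt u))"
proof -
  have "gf odds (\<lambda>u. single 1 1 + msubst shift1 (wt u))
      = gf evens (\<lambda>u. (single 1 2 + single 2 1) + msubst shift2 (wt u))"
    unfolding gf_odds
    by (rule gf_cong) (simp only: wt_join_Nil, rule msubst_shift1_shift1, simp add: lookup_wt)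
  also have "\<dots> = monomial (single 1 2 + single 2 1) * gf evens (\<lambda>u. msubst shift2 (wt u))"
    by (rule monomial_times_gf[OF finite_fibres_shift2[OF evens_subset], symmetric])
  also have "monomial (single 1 2 + single 2 1) = (mvar 1)\<^sup>2 * mvar 2"
    by (simp only: mvar_eq_monomial monomial_power of_nat_mult_single monomial_mult)
  finally show ?thesis .
qed

lemma gf_Nil: "gf {[]} wt = 1"
proof (rule mfps_eqI)
  fix m
  have "{x \<in> {[]}. wt x = m} = (if m = 0 then {[]} else {})" by (auto simp: wt_Nil)
  then show "mcoeff (gf {[]} wt) m = mcoeff 1 m" by (simp only: mcoeff_gf mcoeff_simps) simp
qed

lemma gf_evens_recursion:
  "(gf evens wt :: 'a::comm_ring_1 mfps) = 1 + (mvar 1 * gf odds wt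
     + gf odds (\<lambda>u. single 1 1 + msubst shift1 (wt u)) * (gf evens wt - 1))"
proof -
  let ?T = "odds \<times> (evens - {[]})" and ?j = "\<lambda>(u, v). join u v"
  have sub: "join [] ` odds \<subseteq> dumont132" "?j ` ?T \<subseteq> dumont132"
    using evens_eq evens_subset by auto
  have 1: "(gf evens wt :: 'a mfps) = gf {[]} wt + gf (join [] ` odds \<union> ?j ` ?T) wt"
    by (subst evens_eq, rule gf_Un)
      (use sub in \<open>auto simp: join_def Nil_in_dumont132 intro!: finite_fibres_wt\<close>)
  have 2: "(gf (join [] ` odds \<union> ?j ` ?T) wt :: 'a mfps) = gf (join [] ` odds) wt + gf (?j ` ?T) wt"
  proof (rule gf_Un)
    \<comment> \<open>By \<open>join_inject\<close> a common element would have \<open>[]\<close> as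
      its left block in \<open>odds\<close>, but that list has even length.\<close>
    show "join [] ` odds \<inter> ?j ` ?T = {}"
      using join_inject Nil_in_dumont132 odds_subset
      by (force simp: odds_def)
  qed (use sub in \<open>auto intro!: finite_fibres_wt\<close>)
  have "(gf (join [] ` odds) wt :: 'a mfps) = gf odds (\<lambda>v. single 1 1 + wt v)"
  proof (subst gf_image)
    show "inj_on (join []) odds"
      using join_inject odds_subset Nil_in_dumont132 unfolding inj_on_def by blast
    show "(gf odds (\<lambda>v. wt (join [] v)) :: 'a mfps) = gf odds (\<lambda>v. single 1 1 + wt v)"
      using wt_join[OF Nil_in_dumont132] odds_subset
      by (intro gf_cong) (auto simp: wt_Nil msubst_0)
  qed
  also have "\<dots> = mvar 1 * gf odds wt"
    unfolding mvar_eq_monomial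
    by (rule monomial_times_gf[symmetric]) (rule finite_fibres_wt[OF odds_subset])
  finally have 3: "(gf (join [] ` odds) wt :: 'a mfps) = mvar 1 * gf odds wt" .
  have "(gf (?j ` ?T) wt :: 'a mfps) = gf ?T (\<lambda>(u, v). (single 1 1 + msubst shift1 (wt u)) + wt v)"
  proof (subst gf_image)
    show "inj_on ?j ?T"
      using join_inject odds_subset evens_subset unfolding inj_on_def by fast
    show "(gf ?T (\<lambda>p. wt (?j p)) :: 'a mfps) = gf ?T (\<lambda>(u, v). (single 1 1 + msubst shift1 (wt u)) + wt v)"
      using wt_join odds_subset evens_subset by (intro gf_cong) auto
  qed
  also have "\<dots> = gf odds (\<lambda>u. single 1 1 + msubst shift1 (wt u)) * gf (evens - {[]}) wt"
  proof (rule gf_times[symmetric])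
    show "finite_fibres odds (\<lambda>u. single 1 1 + msubst shift1 (wt u))"
      by (rule finite_fibres_length[OF odds_subset])
        (auto simp: lookup_add lookup_msubst_shift1 lookup_wt_1[unfolded One_nat_def])
    show "finite_fibres (evens - {[]}) wt"
      using evens_subset by (intro finite_fibres_wt) auto
  qed
  finally have 4: "(gf (?j ` ?T) wt :: 'a mfps)
      = gf odds (\<lambda>u. single 1 1 + msubst shift1 (wt u)) * gf (evens - {[]}) wt" .
  have 5: "(gf (evens - {[]}) wt :: 'a mfps) = gf evens wt - 1"
  proof -
    have "(gf ({[]} \<union> (evens - {[]})) wt :: 'a mfps) = gf {[]} wt + gf (evens - {[]}) wt"
      using evens_subset Nil_in_dumont132 by (intro gf_Un finite_fibres_wt) auto
    moreover have "{[]} \<union> (evens - {[]}) = evens"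
      using Nil_in_dumont132 by (auto simp: evens_def)
    ultimately show ?thesis by (simp only: gf_Nil) (metis add_diff_cancel_left')
  qed
  show ?thesis
    by (rule trans[OF 1]) (simp only: gf_Nil 2 3 4 5)
qed

section \<open>Even and odd parts of the generating function\<close>

lemma dumont_gf_eq_gf: "dumont_gf = (gf dumont132 wt :: 'a::comm_ring_1 mfps)"
proof -
  have "(\<Prod>j = 1..length w. mvar j ^ occurrences [1..<j + 1] w) = (monomial (wt w) :: 'a mfps)" for w
    by (simp only: occurrences_incr mvar_eq_monomial monomial_power of_nat_mult_single
        monomial_sum wt_def)
  then have "(dumont_gf :: 'a mfps) = mfps_Sum (\<lambda>w. monomial (wt w)) dumont132"
    by (simp only: dumont_gf_def)
  also have "\<dots> = gf dumont132 wt"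
  proof (rule mfps_eqI)
    fix m
    let ?X = "{w \<in> dumont132. wt w = m}"
    have "mcoeff (mfps_Sum (\<lambda>w. monomial (wt w) :: 'a mfps) dumont132) m
        = (\<Sum>w | w \<in> dumont132 \<and> (if m = wt w then 1 else 0) \<noteq> (0 :: 'a). if m = wt w then 1 else 0)"
      by (simp add: mfps_Sum_def)
    also have "\<dots> = (\<Sum>w\<in>?X. 1)"
      by (rule sum.cong) (auto split: if_splits)
    finally show "mcoeff (mfps_Sum (\<lambda>w. monomial (wt w) :: 'a mfps) dumont132) m
        = mcoeff (gf dumont132 wt) m"
      by simp
  qed
  finally show ?thesis .
qed

lemma dumont_gf_split: "dumont_gf = gf evens wt + gf odds wt"
proof -
  have "dumont132 = evens \<union> odds" by (auto simp: evens_def odds_def)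
  moreover have "gf (evens \<union> odds) wt = gf evens wt + gf odds wt"
    by (rule gf_Un) (auto simp: evens_def odds_def intro!: finite_fibres_wt)
  ultimately show ?thesis by (simp add: dumont_gf_eq_gf)
qed

text \<open>The exponent of \<open>x\<^sub>1\<close> is the size of the permutation, so negating
  this variable changes the sign of exactly the odd-sized contributions.\<close>

lemma dumont_gf_neg_split: "dumont_gf_neg = gf evens wt - gf odds wt"
proof (rule mfps_eqI)
  fix n
  have "card {w \<in> evens. wt w = n} = 0" if "odd (lookup n 1)"
  proof -
    have "{w \<in> evens. wt w = n} = {}" using that lookup_wt_1 by (auto simp: evens_def)
    then show ?thesis by (simp only: card.empty)
  qed
  moreover have "card {w \<in> odds. wt w = n} = 0" if "even (lookup n 1)"
  proof -
    have "{w \<in> odds. wt w = n} = {}" using that lookup_wt_1 by (auto simp: odds_def)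
    then show ?thesis by (simp only: card.empty)
  qed
  ultimately show "mcoeff dumont_gf_neg n = mcoeff (gf evens wt - gf odds wt) n"
    unfolding dumont_gf_neg_def subst_neg_first dumont_gf_split
    by (cases "even (lookup n 1)") (simp_all del: card_eq_0_iff One_nat_def)
qed

text \<open>The factor \<open>1 / 2\<close> is a quotient of series; it is genuine because the
  constant coefficient of the series 2 is non-zero in characteristic 0.\<close>

lemma half_mult_double: "1 / 2 * (f + f) = (f :: 'a::field_char_0 mfps)"
proof -
  have "mcoeff (1 + 1 :: 'a mfps) 0 = 1 + 1"
    by (simp only: mcoeff_simps) simp
  then have "mcoeff (2 :: 'a mfps) 0 = 2" by (simp only: one_add_one)
  then have "2 * inverse (2 :: 'a mfps) = 1"
    by (intro mfps_inverse_mult) simp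
  moreover have "1 / 2 * (f + f) = (2 * inverse 2) * f"
    unfolding divide_mfps_def by (simp only: mult_2[symmetric] mult_1 ac_simps)
  ultimately show ?thesis by (simp only: mult_1)
qed

lemma dumont_A_eq_gf: "dumont_A = (gf evens wt :: 'a::field_char_0 mfps)"
proof -
  have "(f + g) + (f - g) = f + f" for f g :: "'a mfps" by (simp add: algebra_simps)
  then show ?thesis
    by (simp only: dumont_A_def dumont_gf_split dumont_gf_neg_split half_mult_double)
qed

lemma dumont_B_eq_gf: "dumont_B = (gf odds wt :: 'a::field_char_0 mfps)"
proof -
  have "(f + g) - (f - g) = g + g" for f g :: "'a mfps" by (simp add: algebra_simps)
  then show ?thesis
    by (simp only: dumont_B_def dumont_gf_split dumont_gf_neg_split half_mult_double)
qed

theorem theorem2p6: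
  shows "(dumont_A :: 'a::field_char_0 mfps) =
           1 + (mvar 1)\<^sup>2 * mfps_subst dumont_A (\<lambda>i. mvar i * mvar (i + 1)) /
             (1 - (mvar 1)\<^sup>2 * mvar 2 *
                mfps_subst dumont_A (\<lambda>i. mvar i * (mvar (i + 1))\<^sup>2 * mvar (i + 2))) \<and>
         (dumont_B :: 'a mfps) = mvar 1 * mfps_subst dumont_A (\<lambda>i. mvar i * mvar (i + 1))"
proof -
  let ?A = "gf evens wt :: 'a mfps"
  let ?A1 = "gf evens (\<lambda>w. msubst shift1 (wt w)) :: 'a mfps"
  let ?A2 = "gf evens (\<lambda>w. msubst shift2 (wt w)) :: 'a mfps"
  let ?U = "(mvar 1)\<^sup>2 * mvar 2 * ?A2"
  have A1: "mfps_subst ?A (\<lambda>i. mvar i * mvar (i + 1)) = ?A1"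
    using subst_gf_monomial[OF finite_fibres_shift1[OF evens_subset]]
    by (simp only: mvar_eq_monomial monomial_mult shift1_def)
  have A2: "mfps_subst ?A (\<lambda>i. mvar i * (mvar (i + 1))\<^sup>2 * mvar (i + 2)) = ?A2"
    using subst_gf_monomial[OF finite_fibres_shift2[OF evens_subset]]
    by (simp only: mvar_eq_monomial monomial_mult monomial_power shift2_def)
  \<comment> \<open>\<open>?U\<close> enumerates odd-sized blocks followed by a maximum, all with a
    positive exponent of \<open>x\<^sub>1\<close>. Thus \<open>1 - ?U\<close> has constant
    coefficient 1 and is a unit.\<close>
  have "mcoeff ?U 0 = 0"
  proof -
    have "{w \<in> odds. single 1 1 + msubst shift1 (wt w) = 0} = {}"
      by (auto dest!: arg_cong[where f = "\<lambda>m. lookup m 1"] simp: lookup_add lookup_single)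
    then show ?thesis
      unfolding gf_odds_shift1[symmetric] by (simp only: mcoeff_gf card.empty of_nat_0)
  qed
  then have inv: "(1 - ?U) * inverse (1 - ?U) = 1"
    by (intro mfps_inverse_mult) simp
  \<comment> \<open>Eliminating the odd series leaves an equation that is linear in
    \<open>?A\<close> once \<open>?A1\<close> and \<open>?A2\<close> are regarded as given.\<close>
  have "?A = 1 + (mvar 1 * (mvar 1 * ?A1) + ?U * (?A - 1))"
    using gf_evens_recursion unfolding gf_odds_wt gf_odds_shift1 .
  then have "(?A - 1) * (1 - ?U) = (mvar 1)\<^sup>2 * ?A1"
    by (simp add: algebra_simps power2_eq_square)
  \<comment> \<open>Multiplication by the inverse of the unit \<open>1 - ?U\<close> turns the linear
    equation into the quotient.\<close>
  then have "(?A - 1) * ((1 - ?U) * inverse (1 - ?U)) = (mvar 1)\<^sup>2 * ?A1 / (1 - ?U)"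
    unfolding divide_mfps_def by (simp only: mult.assoc[symmetric])
  then have "?A = 1 + (mvar 1)\<^sup>2 * ?A1 / (1 - ?U)"
    unfolding inv by (simp add: algebra_simps)
  then show ?thesis
    unfolding dumont_A_eq_gf dumont_B_eq_gf A1 A2 using gf_odds_wt by blast
qed

end
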